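(* Let $\mathbb{K}$ be $\mathbb{R}$ or $\mathbb{C}$ and fix $q\in\mathbb{N}$. Let $g(y)=\sum_{n=0}^{\infty} g_n y^n$ be a formal power series in one variable over $\mathbb{K}$, and let $f(x)=\sum_{c\in C} f_c X^c$ be a formal power series in $q$ variables over $\mathbb{K}$ such that $f\neq bI$ for every $b\in\mathbb{K}$. Put $b_0:=f_{(0,\ldots,0)}$. Then the composition $g\circ f$ exists if and only if for every $k\in\mathbb{N}_0$ the series $$\sum_{n=k}^{\infty}\binom{n}{k} g_n b_0^{\,n-k}$$ converges in $\mathbb{K}$.
   Context: $\mathbb{N}$ is the set of positive integers, $\mathbb{N}_0=\mathbb{N}\cup\{0\}$, and $C:=\mathbb{N}_0^q$. A formal power series in $q$ variables $x=(x_1,\ldots,x_q)$ over $\mathbb{K}$ is a formal sum $f(x)=\sum_{c\in C}f_cX^c$ with $f_c\in\mathbb{K}$ and $X^c=x_1^{c_1}\cdots x_q^{c_q}$; it is identified with the map $C\ni c\mapsto f_c\in\mathbb{K}$. Scalar multiples are coefficientwise, and the product is the Cauchy product $(fg)_c=\sum_{a,b\in C,\ a+b=c}f_ag_b$. $I$ denotes the series with $I_{(0,\ldots,0)}=1$ and $I_c=0$ for all other $c$ (the multiplicative identity). Powers: $f^0:=I$ and $f^n$ is the $n$-fold Cauchy product of $f$ with itself; $f^n_c:=(f^n)_c$. Composition: for $g(y)=\sum_{n=0}^\infty g_ny^n$ in one variable and $f$ in $q$ variables, the composition $g\circ f$ is said to exist if for every $c\in C$ the series $\sum_{n=0}^{\infty}g_nf^n_c$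 converges in $\mathbb{K}$ (in the ordinary sense of convergence of partial sums, not necessarily absolutely); in that case $g\circ f$ is the $q$-variable formal power series with coefficients $(g\circ f)_c:=\sum_{n=0}^{\infty}g_nf^n_c$. Convention: $a^0:=1$ for all $a\in\mathbb{K}$, including $a=0$. *)

theory Defs
  imports "HOL-Analysis.Analysis" "HOL-Computational_Algebra.Formal_Power_Series"
begin

text \<open>
  A formal power series in \<open>q\<close> variables is identified with its coefficient map on the
  multi-indices \<open>nat ^ 'q\<close>, where \<open>q = CARD('q) \<ge> 1\<close>.
\<close>
type_synonym ('a, 'q) mfps = "nat ^ 'q \<Rightarrow> 'a"

definition mfps_one :: "('a::comm_ring_1, 'q::finite) mfps" where
  "mfps_one = (\<lambda>c. if c = 0 then 1 else 0)"

definition mfps_scale :: "'a::comm_ring_1 \<Rightarrow> ('a, 'q::finite) mfps \<Rightarrow> ('a, 'q) mfps" where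
  "mfps_scale b f = (\<lambda>c. b * f c)"

definition mfps_mult ::
    "('a::comm_ring_1, 'q::finite) mfps \<Rightarrow> ('a, 'q) mfps \<Rightarrow> ('a, 'q) mfps" where
  "mfps_mult f g = (\<lambda>c. \<Sum>(a, b) | a + b = c. f a * g b)"

text \<open>The index set of the Cauchy product is finite, so the sum above is a genuine finite sum.\<close>
lemma finite_mfps_mult_index: "finite {(a, b). a + b = (c :: nat ^ 'q::finite)}"
proof -
  let ?A = "{a :: nat ^ 'q. \<forall>i. a $ i \<in> {..c $ i}}"
  have "finite (vec_lambda ` (Pi\<^sub>E UNIV (\<lambda>i. {..c $ i})) :: (nat ^ 'q) set)"
    by (intro finite_imageI finite_PiE) auto
  moreover have "?A \<subseteq> vec_lambda ` (Pi\<^sub>E UNIV (\<lambda>i. {..c $ i}))"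
  proof
    fix a assume "a \<in> ?A"
    then have "vec_nth a \<in> Pi\<^sub>E UNIV (\<lambda>i. {..c $ i})" by auto
    then show "a \<in> vec_lambda ` (Pi\<^sub>E UNIV (\<lambda>i. {..c $ i}))"
      by (metis image_eqI vec_nth_inverse)
  qed
  ultimately have "finite ?A" by (rule rev_finite_subset)
  then have "finite (?A \<times> ?A)" by blast
  moreover have "{(a, b). a + b = c} \<subseteq> ?A \<times> ?A" by auto
  ultimately show ?thesis by (rule rev_finite_subset)
qed

primrec mfps_power :: "('a::comm_ring_1, 'q::finite) mfps \<Rightarrow> nat \<Rightarrow> ('a, 'q) mfps" where
  "mfps_power f 0 = mfps_one"
| "mfps_power f (Suc n) = mfps_mult f (mfps_power f n)"

text \<open>
  Existence of the composition of \<open>g\<close> with \<open>f\<close>. Here \<open>f\<close> may have a nonzero constant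
  coefficient, so this differs from \<^const>\<open>fps_compose\<close>; the convergence is that of the
  partial sums, not necessarily absolute.
\<close>
definition mfps_compose_exists ::
    "'a::real_normed_field fps \<Rightarrow> ('a, 'q::finite) mfps \<Rightarrow> bool" where
  "mfps_compose_exists g f \<longleftrightarrow> (\<forall>c. summable (\<lambda>n. fps_nth g n * mfps_power f n c))"

end

theory Submission
  imports Defs "HOL-Computational_Algebra.Primes"
begin

text \<open>
  Write \<open>f = b\<^sub>0 I + h\<close> with \<open>h \<noteq> 0\<close> without constant term. By the binomial theorem
  \<open>(f\<^sup>n)\<^sub>c = (\<Sum>j. (n choose j) b\<^sub>0\<^bsup>n - j\<^esup> (h\<^sup>j)\<^sub>c)\<close>, where for fixed \<open>c\<close> only finitely
  many \<open>j\<close> contribute; so convergence of all the binomial series yields the composition.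
  For the converse, order the multi-indices by the weight \<open>W(c) = (\<Prod>i. p\<^sub>i\<^bsup>c\<^sub>i\<^esup>)\<close> with distinct
  primes \<open>p\<^sub>i\<close>, an injective monoid homomorphism into the positive integers, and let \<open>c\<close> be the
  index of least weight in the support of \<open>h\<close>. The coefficient of \<open>h\<^sup>j\<close> at \<open>k c\<close> is
  \<open>h\<^sub>c\<^sup>k \<noteq> 0\<close> for \<open>j = k\<close> and vanishes for \<open>j > k\<close>. The system is therefore triangular, and
  convergence of the binomial series follows by strong induction on \<open>k\<close>.
\<close>

lemma mfps_mult_add_left:
  "mfps_mult (\<lambda>c. f c + g c) h c = mfps_mult f h c + mfps_mult g h c"
  by (simp add: mfps_mult_def case_prod_unfold distrib_right sum.distrib)

lemma mfps_mult_scale_one: "mfps_mult (mfps_scale b mfps_one) h c = b * h c"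
proof -
  have "mfps_mult (mfps_scale b mfps_one) h c =
      (\<Sum>z\<in>{(x, y). x + y = c}. if z = (0, c) then b * h c else 0)"
    unfolding mfps_mult_def by (rule sum.cong) (auto simp: mfps_scale_def mfps_one_def split: if_splits)
  also have "\<dots> = b * h c"
    by (subst sum.delta[OF finite_mfps_mult_index]) simp
  finally show ?thesis .
qed

lemma mfps_mult_sum_right:
  "mfps_mult h (\<lambda>c. \<Sum>j\<in>A. t j * F j c) c = (\<Sum>j\<in>A. t j * mfps_mult h (F j) c)"
proof -
  have "mfps_mult h (\<lambda>c. \<Sum>j\<in>A. t j * F j c) c =
      (\<Sum>z | fst z + snd z = c. \<Sum>j\<in>A. t j * (h (fst z) * F j (snd z)))"
    by (simp add: mfps_mult_def case_prod_unfold sum_distrib_left mult.left_commute)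
  also have "\<dots> = (\<Sum>j\<in>A. t j * mfps_mult h (F j) c)"
    by (subst sum.swap) (simp add: mfps_mult_def case_prod_unfold sum_distrib_left)
  finally show ?thesis .
qed

text \<open>Each induction step multiplies by bI + h on the left; after an index shift, Pascal's
  rule merges the two resulting sums.\<close>

lemma mfps_power_binomial:
  fixes h :: "('a::comm_ring_1, 'q::finite) mfps" and b :: 'a
  defines "f \<equiv> (\<lambda>c. mfps_scale b mfps_one c + h c)"
  shows "mfps_power f n c = (\<Sum>j\<le>n. of_nat (n choose j) * b ^ (n - j) * mfps_power h j c)"
proof (induction n arbitrary: c)
  case 0
  then show ?case by simp
next
  case (Suc n)
  let ?t = "\<lambda>n j. of_nat (n choose j) * b ^ (n - j) :: 'a"
  let ?H = "\<lambda>j. mfps_power h j c"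
  have IH: "mfps_power f n = (\<lambda>c. \<Sum>j\<le>n. ?t n j * mfps_power h j c)"
    using Suc.IH by blast
  \<comment> \<open>For j > n the truncated exponents differ from the intended ones, but the
    binomial coefficient is then 0.\<close>
  have low: "b * ?t n j = of_nat (n choose j) * b ^ (Suc n - j)" for j
    by (cases "j \<le> n") (simp_all add: Suc_diff_le mult_ac binomial_eq_0)
  have "mfps_power f (Suc n) c = b * mfps_power f n c + mfps_mult h (mfps_power f n) c"
    unfolding mfps_power.simps by (subst f_def) (simp add: mfps_mult_add_left mfps_mult_scale_one)
  also have "b * mfps_power f n c = (\<Sum>j\<le>n. b * ?t n j * ?H j)"
    by (simp add: IH sum_distrib_left mult.assoc)
  also have "\<dots> = (\<Sum>j\<le>Suc n. of_nat (n choose j) * b ^ (Suc n - j) * ?H j)"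
    by (simp only: low sum.atMost_Suc) (simp add: binomial_eq_0)
  also have "\<dots> = b ^ Suc n * ?H 0 +
      (\<Sum>j\<le>n. of_nat (n choose Suc j) * b ^ (n - j) * ?H (Suc j))"
    by (subst sum.atMost_Suc_shift) simp
  also have "mfps_mult h (mfps_power f n) c = (\<Sum>j\<le>n. ?t n j * ?H (Suc j))"
    unfolding IH by (simp only: mfps_mult_sum_right mfps_power.simps)
  also have "b ^ Suc n * ?H 0 + (\<Sum>j\<le>n. of_nat (n choose Suc j) * b ^ (n - j) * ?H (Suc j)) +
      (\<Sum>j\<le>n. ?t n j * ?H (Suc j)) = b ^ Suc n * ?H 0 + (\<Sum>j\<le>n. ?t (Suc n) (Suc j) * ?H (Suc j))"
    by (simp add: sum.distrib[symmetric] algebra_simps del: mfps_power.simps)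
  also have "\<dots> = (\<Sum>j\<le>Suc n. ?t (Suc n) j * ?H j)"
    by (subst sum.atMost_Suc_shift) simp
  finally show ?case .
qed

text \<open>Injectivity is unique factorization: each exponent \<open>c $ i\<close> is recovered as
  the multiplicity of the i-th prime in \<open>W c\<close>.\<close>

lemma exists_injective_weight:
  obtains W :: "nat ^ 'q::finite \<Rightarrow> nat"
  where "\<And>c. W c > 0" "W 0 = 1" "\<And>a b. W (a + b) = W a * W b" "inj W"
proof -
  obtain P :: "nat set" where P: "P \<subseteq> {p. prime p}" "finite P" "card P = CARD('q)"
    using infinite_arbitrarily_large[OF primes_infinite] by blast
  then obtain p where p: "bij_betw p (UNIV :: 'q set) P"
    using finite_same_card_bij[of "UNIV :: 'q set" P] by auto
  have prime: "prime (p i)" for i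
    using P(1) bij_betwE[OF p] by auto
  have nonzero: "p i \<noteq> 0" for i
    using prime[of i] by auto
  have inj_p: "p i = p j \<longleftrightarrow> i = j" for i j
    using p by (auto simp: bij_betw_def inj_on_def)
  define W where "W c = (\<Prod>i\<in>UNIV. p i ^ (c $ i))" for c :: "nat ^ 'q"
  have mult_W: "multiplicity (p i) (W c) = c $ i" for i c
  proof -
    have "multiplicity (p i) (W c) = (\<Sum>j\<in>UNIV. multiplicity (p i) (p j ^ (c $ j)))"
      unfolding W_def by (subst prime_elem_multiplicity_prod_distrib) (auto simp: prime nonzero)
    also have "\<dots> = (\<Sum>j\<in>UNIV. if j = i then c $ i else 0)"
      by (rule sum.cong) (auto simp: prime multiplicity_distinct_prime_power inj_p)
    finally show ?thesis by simp
  qed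
  show thesis
  proof
    show "W c > 0" for c
      unfolding W_def using prime by (intro prod_pos zero_less_power ballI prime_gt_0_nat)
    show "W 0 = 1" by (simp add: W_def)
    show "W (a + b) = W a * W b" for a b
      by (simp add: W_def power_add prod.distrib)
    show "inj W"
      by (metis injI mult_W vec_eq_iff)
  qed
qed

locale injective_weight =
  fixes W :: "nat ^ 'q::finite \<Rightarrow> nat"
  assumes weight_pos: "W c > 0"
    and weight_zero: "W 0 = 1"
    and weight_add: "W (a + b) = W a * W b"
    and weight_inj: "inj W"
begin

text \<open>\<open>((+) c ^^ k) 0\<close> is the multi-index k c, written as an iteration so that it
  unfolds in step with \<open>mfps_power\<close>.\<close>

lemma weight_funpow_add: "W (((+) c ^^ k) 0) = W c ^ k"
  by (induction k) (simp_all add: weight_zero weight_add)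

text \<open>A nonzero coefficient at e requires splitting e into j indices from the support of h;
  their weights, each at least M, multiply to \<open>W e\<close>.\<close>

lemma mfps_power_weight_ge:
  fixes h :: "('a::comm_ring_1, 'q) mfps"
  assumes supp: "\<And>a. h a \<noteq> 0 \<Longrightarrow> M \<le> W a"
    and "mfps_power h j e \<noteq> 0"
  shows "M ^ j \<le> W e"
  using assms(2)
proof (induction j arbitrary: e)
  case 0
  then show ?case using weight_pos[of e] by simp
next
  case (Suc j)
  then have "(\<Sum>(a, b) | a + b = e. h a * mfps_power h j b) \<noteq> 0"
    by (simp add: mfps_mult_def)
  then obtain a b where ab: "a + b = e" "h a * mfps_power h j b \<noteq> 0"
    by (auto elim: sum.not_neutral_contains_not_neutral)
  then have "h a \<noteq> 0" "mfps_power h j b \<noteq> 0" by auto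
  then have "M \<le> W a" "M ^ j \<le> W b" using supp Suc.IH by blast+
  then show ?case using ab(1) weight_add by (auto intro: mult_mono)
qed

text \<open>Only the splitting of k c into k copies of c contributes: the weights of the parts are
  at least \<open>W c\<close> and multiply to \<open>W c ^ k\<close>, so all equal
  \<open>W c\<close>, and injectivity makes each part c.\<close>

lemma mfps_power_least_coeff:
  fixes h :: "('a::comm_ring_1, 'q) mfps"
  assumes supp: "\<And>a. h a \<noteq> 0 \<Longrightarrow> W c \<le> W a"
  shows "mfps_power h k (((+) c ^^ k) 0) = h c ^ k"
proof (induction k)
  case 0
  then show ?case by (simp add: mfps_one_def)
next
  case (Suc k)
  let ?e = "((+) c ^^ k) 0"
  have "h a * mfps_power h k b = (if (a, b) = (c, ?e) then h c ^ Suc k else 0)"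
    if ab: "a + b = c + ?e" for a b
  proof (cases "h a * mfps_power h k b = 0")
    case True
    then show ?thesis using Suc.IH by auto
  next
    case False
    then have "h a \<noteq> 0" "mfps_power h k b \<noteq> 0" by auto
    then have le: "W c \<le> W a" "W c ^ k \<le> W b"
      using supp mfps_power_weight_ge[OF supp] by blast+
    have "W a * W b = W c * W c ^ k"
      using arg_cong[OF ab, of W] by (simp add: weight_add weight_funpow_add)
    moreover have "W c * W c ^ k < W a * W b" if "W c < W a"
      using that le weight_pos by (intro mult_less_le_imp_less) auto
    ultimately have "W a = W c" using le(1) by (metis le_neq_implies_less less_irrefl)
    then have "a = c" using weight_inj by (simp add: inj_eq)
    then show ?thesis using ab Suc.IH by simp
  qed
  then have "mfps_power h (Suc k) (c + ?e) =
      (\<Sum>z\<in>{(a, b). a + b = c + ?e}. if z = (c, ?e) then h c ^ Suc k else 0)"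
    unfolding mfps_power.simps mfps_mult_def by (intro sum.cong) (auto split: if_splits)
  also have "\<dots> = h c ^ Suc k"
    by (subst sum.delta[OF finite_mfps_mult_index]) simp
  finally show ?case by simp
qed

end

text \<open>The summation index is m = n - k. A general normed field covers the real and the complex
  case at once.\<close>

lemma compose_exists_iff:
  fixes g :: "'a::real_normed_field fps" and f :: "('a, 'q::finite) mfps"
  assumes nonconst: "\<And>b. f \<noteq> mfps_scale b mfps_one"
  shows "mfps_compose_exists g f \<longleftrightarrow>
    (\<forall>k. summable (\<lambda>m. of_nat ((k + m) choose k) * fps_nth g (k + m) * f 0 ^ m))"
proof -
  obtain W :: "nat ^ 'q \<Rightarrow> nat" where "injective_weight W"
    using exists_injective_weight unfolding injective_weight_def by metis
  then interpret injective_weight W .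
  define h where "h = (\<lambda>c. if c = 0 then 0 else f c)"
  have f_eq: "f = (\<lambda>c. mfps_scale (f 0) mfps_one c + h c)"
    by (auto simp: h_def mfps_scale_def mfps_one_def)
  have "\<exists>c. h c \<noteq> 0"
    using nonconst[of "f 0"] by (subst (asm) f_eq) (auto simp: fun_eq_iff)
  then obtain c where c: "h c \<noteq> 0" "\<And>a. h a \<noteq> 0 \<Longrightarrow> W c \<le> W a"
    using exists_least_iff[of "\<lambda>w. \<exists>a. h a \<noteq> 0 \<and> W a = w"] by (metis not_less)
  \<comment> \<open>Since h has no constant term, c is not 0. With \<open>W c > 1\<close> the powers
    \<open>W c ^ j\<close> are unbounded, so at a fixed index almost all powers of h vanish.\<close>
  have "W c \<noteq> 1"
    using c(1) weight_inj weight_zero by (metis h_def injD)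
  then have Wc: "W c > 1" using weight_pos[of c] by linarith
  \<comment> \<open>All the series are indexed by the same n, so that they can be combined termwise;
    the terms with n < k are 0.\<close>
  define s where "s k n = fps_nth g n * (of_nat (n choose k) * f 0 ^ (n - k))" for k n
  have s_iff: "summable (\<lambda>m. of_nat ((k + m) choose k) * fps_nth g (k + m) * f 0 ^ m) \<longleftrightarrow>
      summable (s k)" for k
    by (subst summable_iff_shift[of "s k" k, symmetric]) (simp add: s_def add.commute mult_ac)
  \<comment> \<open>The bound N does not depend on n, so summing over n yields a fixed finite
    combination of the series \<open>s j\<close>.\<close>
  have expand: "fps_nth g n * mfps_power f n e = (\<Sum>j\<le>N. mfps_power h j e * s j n)"
    if N: "\<And>j. j > N \<Longrightarrow> mfps_power h j e = 0" for n e N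
  proof -
    have "mfps_power f n e = (\<Sum>j\<le>n. of_nat (n choose j) * f 0 ^ (n - j) * mfps_power h j e)"
      by (subst f_eq) (rule mfps_power_binomial)
    also have "\<dots> = (\<Sum>j\<le>max n N. of_nat (n choose j) * f 0 ^ (n - j) * mfps_power h j e)"
      by (rule sum.mono_neutral_left) (auto simp: binomial_eq_0)
    also have "\<dots> = (\<Sum>j\<le>N. of_nat (n choose j) * f 0 ^ (n - j) * mfps_power h j e)"
      by (rule sum.mono_neutral_right) (auto simp: N)
    finally show ?thesis by (simp add: s_def sum_distrib_left mult_ac)
  qed
  have vanish: "mfps_power h j e = 0" if "W e < W c ^ j" for j e
    using mfps_power_weight_ge[of h "W c" j e] c(2) that by fastforce
  show ?thesis unfolding s_iff
  proof
    assume s: "\<forall>k. summable (s k)"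
    show "mfps_compose_exists g f" unfolding mfps_compose_exists_def
    proof
      fix e
      \<comment> \<open>The bound N = \<open>W e\<close> suffices, because \<open>W c > 1\<close>
        gives \<open>W e < j < W c ^ j\<close>.\<close>
      have "mfps_power h j e = 0" if "j > W e" for j
        using that power_gt_expt[of "W c" j] Wc by (intro vanish) linarith
      then show "summable (\<lambda>n. fps_nth g n * mfps_power f n e)"
        using s by (simp add: expand[of "W e"] summable_sum summable_mult)
    qed
  next
    assume ex: "mfps_compose_exists g f"
    show "\<forall>k. summable (s k)"
    proof
      fix k
      show "summable (s k)"
      proof (induction k rule: less_induct)
        case (less k)
        let ?e = "((+) c ^^ k) 0"
        let ?H = "\<lambda>j. mfps_power h j ?e"
        have "?H j = 0" if "j > k" for j
          using that Wc by (intro vanish) (simp add: weight_funpow_add power_strict_increasing)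
        then have "fps_nth g n * mfps_power f n ?e = (\<Sum>j<k. ?H j * s j n) + ?H k * s k n" for n
          by (subst expand[of k]) (simp_all add: lessThan_Suc_atMost[symmetric])
        \<comment> \<open>Solving for the diagonal term leaves a series that converges by
          assumption, minus earlier ones covered by the induction hypothesis.\<close>
        then have "?H k * s k n = fps_nth g n * mfps_power f n ?e - (\<Sum>j<k. ?H j * s j n)" for n
          by simp
        moreover have "summable (\<lambda>n. fps_nth g n * mfps_power f n ?e - (\<Sum>j<k. ?H j * s j n))"
          using ex less.IH unfolding mfps_compose_exists_def
          by (intro summable_diff summable_sum summable_mult) auto
        ultimately have "summable (\<lambda>n. ?H k * s k n)" by simp
        moreover have "?H k \<noteq> 0"
          using c mfps_power_least_coeff[of h c k] by simp
        ultimately show ?case by (simp add: summable_cmult_iff)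
      qed
    qed
  qed
qed

theorem theorem10:
  shows
    "(\<forall>(g :: real fps) (f :: (real, 'q::finite) mfps).
        (\<forall>b. f \<noteq> mfps_scale b mfps_one) \<longrightarrow>
        (mfps_compose_exists g f \<longleftrightarrow>
          (\<forall>k. summable (\<lambda>m. of_nat ((k + m) choose k) * fps_nth g (k + m) * f 0 ^ m))))
     \<and>
     (\<forall>(g :: complex fps) (f :: (complex, 'q::finite) mfps).
        (\<forall>b. f \<noteq> mfps_scale b mfps_one) \<longrightarrow>
        (mfps_compose_exists g f \<longleftrightarrow>
          (\<forall>k. summable (\<lambda>m. of_nat ((k + m) choose k) * fps_nth g (k + m) * f 0 ^ m))))"
  by (intro conjI allI impI compose_exists_iff) auto

end
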